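(* Let $Y_1$ and $Y_2$ be subspaces of a path-connected space $X$. Then $\mathrm{TC}_X(Y_1\times Y_2)=1$ if and only if the inclusions $Y_1\hookrightarrow X$ and $Y_2\hookrightarrow X$ are both nullhomotopic.
   Context: $I=[0,1]$. For a space $X$, $P(X)$ is the space of all continuous maps $\sigma\colon I\to X$ with the compact-open topology. For $A\subseteq X\times X$, $P_X(A)\subseteq P(X)$ is the subspace of paths $\sigma$ with $(\sigma(0),\sigma(1))\in A$, and $\mathrm{TC}_X(A)$ is the smallest integer $k$ such that $A$ has a cover by sets $U_1,\dots,U_k$ open in $A$ for which there are continuous maps $s_i\colon U_i\to P_X(A)$ with $s_i(x,y)(0)=x$ and $s_i(x,y)(1)=y$ for all $(x,y)\in U_i$; if no such $k$ exists, $\mathrm{TC}_X(A)=\infty$. A map is nullhomotopic if it is homotopic to a constant map. *)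

theory Defs
  imports "HOL-Analysis.Analysis" "HOL-Library.Extended_Nat"
begin

text \<open>Maps are taken extensional, so that each continuous map on \<open>topspace X\<close> is represented
  by exactly one HOL function.\<close>

definition continuous_maps :: "'a topology \<Rightarrow> 'b topology \<Rightarrow> ('a \<Rightarrow> 'b) set" where
  "continuous_maps X Y = {f \<in> extensional (topspace X). continuous_map X Y f}"

definition compact_open_topology :: "'a topology \<Rightarrow> 'b topology \<Rightarrow> ('a \<Rightarrow> 'b) topology" where
  "compact_open_topology X Y = topology_generated_by
     {{f \<in> continuous_maps X Y. f ` K \<subseteq> V} | K V. compactin X K \<and> openin Y V}"

lemma topspace_compact_open_topology:
  "topspace (compact_open_topology X Y) = continuous_maps X Y"
proof -
  have "continuous_maps X Y \<in> {{f \<in> continuous_maps X Y. f ` K \<subseteq> V} | K V. compactin X K \<and> openin Y V}"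
    by (intro CollectI exI[of _ "{}"]) auto
  then show ?thesis
    unfolding compact_open_topology_def topology_generated_by_topspace by blast
qed

definition path_space :: "'a topology \<Rightarrow> (real \<Rightarrow> 'a) topology" where
  "path_space X = compact_open_topology (top_of_set {0..1}) X"

definition path_space_on :: "'a topology \<Rightarrow> ('a \<times> 'a) set \<Rightarrow> (real \<Rightarrow> 'a) topology" where
  "path_space_on X A = subtopology (path_space X) {\<sigma>. (\<sigma> 0, \<sigma> 1) \<in> A}"

definition admits_motion_planner :: "'a topology \<Rightarrow> ('a \<times> 'a) set \<Rightarrow> ('a \<times> 'a) set \<Rightarrow> bool" where
  "admits_motion_planner X A U \<longleftrightarrow>
     (\<exists>s. continuous_map (subtopology (prod_topology X X) U) (path_space_on X A) s \<and>
          (\<forall>(x, y) \<in> U. s (x, y) 0 = x \<and> s (x, y) 1 = y))"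

text \<open>The infimum of the empty set in \<^typ>\<open>enat\<close> is \<open>\<infinity>\<close>. The value \<open>0\<close> is attained only
  for \<open>A = {}\<close>.\<close>

definition TC :: "'a topology \<Rightarrow> ('a \<times> 'a) set \<Rightarrow> enat" where
  "TC X A = Inf {enat k | k. \<exists>U :: nat \<Rightarrow> ('a \<times> 'a) set.
     (\<forall>i<k. openin (subtopology (prod_topology X X) A) (U i) \<and> admits_motion_planner X A (U i)) \<and>
     A = (\<Union>i<k. U i)}"

definition nullhomotopic :: "'a topology \<Rightarrow> 'b topology \<Rightarrow> ('a \<Rightarrow> 'b) \<Rightarrow> bool" where
  "nullhomotopic X Y f \<longleftrightarrow>
     (\<exists>c \<in> topspace Y. homotopic_with (\<lambda>_. True) X Y f (\<lambda>_. c))"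

end

theory Submission
  imports Defs
begin

text \<open>The unit interval is compact Hausdorff, so the exponential law turns a motion planner on
  \<open>U\<close> into a homotopy between the two projections \<open>U \<rightarrow> X\<close>, and conversely. Restricting such a
  homotopy on \<open>Y1 \<times> Y2\<close> to a slice contracts one of the factors in \<open>X\<close>. Conversely,
  contractions of both factors make each projection homotopic to a constant map, and constant
  maps into a path-connected space are homotopic.\<close>

text \<open>The reason is the tube lemma: if \<open>h\<close> sends \<open>K \<times> {z}\<close>
  into an open \<open>V\<close> and \<open>K\<close> is compact, it sends
  \<open>K \<times> N'\<close> into \<open>V\<close> for some neighbourhood \<open>N'\<close> of
  \<open>z\<close>. The \<open>restrict\<close> places the curried values in the extensional
  representatives that form the compact-open space.\<close>

lemma continuous_map_curry_compact_open:
  assumes h: "continuous_map (prod_topology T Z) X h"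
  shows "continuous_map Z (compact_open_topology T X) (\<lambda>z. restrict (\<lambda>t. h (t, z)) (topspace T))"
    (is "continuous_map Z _ ?s")
proof -
  have mem: "?s z \<in> continuous_maps T X" if "z \<in> topspace Z" for z
  proof -
    have "continuous_map T (prod_topology T Z) (\<lambda>t. (t, z))"
      using that by (simp add: continuous_map_pairedI)
    from continuous_map_compose[OF this h] have "continuous_map T X (?s z)"
      by (rule continuous_map_eq) simp
    then show ?thesis
      by (simp add: continuous_maps_def)
  qed
  have opn: "openin Z (?s -` {f \<in> continuous_maps T X. f ` K \<subseteq> V} \<inter> topspace Z)"
    if K: "compactin T K" and V: "openin X V" for K V
  proof (subst openin_subopen, intro ballI)
    fix z assume z: "z \<in> ?s -` {f \<in> continuous_maps T X. f ` K \<subseteq> V} \<inter> topspace Z"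
    let ?W = "{p \<in> topspace (prod_topology T Z). h p \<in> V}"
    have KT: "K \<subseteq> topspace T"
      by (simp add: K compactin_subset_topspace)
    have "openin (prod_topology T Z) ?W"
      using h V by (rule openin_continuous_map_preimage)
    \<comment> \<open>Since \<open>K\<close> lies in \<open>topspace T\<close>, the restriction
      changes nothing on \<open>K\<close>.\<close>
    moreover have "K \<times> {z} \<subseteq> ?W"
      using z KT by (auto simp: image_subset_iff subset_iff)
    ultimately obtain N N' where N: "openin T N" "openin Z N'" "K \<subseteq> N" "z \<in> N'" "N \<times> N' \<subseteq> ?W"
      using tube_lemma_left[of T Z ?W K z] K z by auto
    have "N' \<subseteq> ?s -` {f \<in> continuous_maps T X. f ` K \<subseteq> V} \<inter> topspace Z"
      using N KT mem openin_subset[OF N(2)] by (auto simp: subset_iff)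
    then show "\<exists>N'. openin Z N' \<and> z \<in> N' \<and>
        N' \<subseteq> ?s -` {f \<in> continuous_maps T X. f ` K \<subseteq> V} \<inter> topspace Z"
      using N by blast
  qed
  show ?thesis
    unfolding compact_open_topology_def continuous_on_generated_topo_iff
  proof (intro conjI allI impI)
    \<comment> \<open>The union of the subbasis is the whole carrier
      \<open>continuous_maps T X\<close>, so this condition reduces to \<open>mem\<close>.\<close>
    show "?s ` topspace Z \<subseteq> \<Union> {{f \<in> continuous_maps T X. f ` K \<subseteq> V} |K V. compactin T K \<and> openin X V}"
      using mem topspace_compact_open_topology[of T X]
      unfolding compact_open_topology_def topology_generated_by_topspace by blast
  qed (use opn in blast)
qed

text \<open>Evaluation is continuous because of local compactness: around \<open>t\<close> there is
  a compact neighbourhood \<open>K\<close> that \<open>s z\<close> still sends into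
  \<open>V\<close>, and sending \<open>K\<close> into \<open>V\<close> is an open condition on the
  map, hence on \<open>z\<close>.\<close>

lemma continuous_map_uncurry_compact_open:
  assumes nb: "neighbourhood_base_of (compactin T) T"
    and s: "continuous_map Z (compact_open_topology T X) s"
  shows "continuous_map (prod_topology T Z) X (\<lambda>(t, z). s z t)"
proof -
  have cont: "continuous_map T X (s z)" if "z \<in> topspace Z" for z
    using continuous_map_image_subset_topspace[OF s] that
    by (auto simp: topspace_compact_open_topology continuous_maps_def)
  have opn: "openin (prod_topology T Z) {p \<in> topspace (prod_topology T Z). (\<lambda>(t, z). s z t) p \<in> V}"
      (is "openin _ ?W") if V: "openin X V" for V
  proof (subst openin_subopen, intro ballI)
    fix p assume "p \<in> ?W"
    then obtain t z where p: "p = (t, z)" and t: "t \<in> topspace T" and z: "z \<in> topspace Z"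
      and stz: "s z t \<in> V"
      by auto
    have "openin T {t \<in> topspace T. s z t \<in> V}"
      using cont[OF z] V by (rule openin_continuous_map_preimage)
    then obtain N K where N: "openin T N" "compactin T K" "t \<in> N" "N \<subseteq> K"
        "K \<subseteq> {t \<in> topspace T. s z t \<in> V}"
      using nb[unfolded neighbourhood_base_of, rule_format, of "{t \<in> topspace T. s z t \<in> V}" t] t stz
      by auto
    let ?B = "{f \<in> continuous_maps T X. f ` K \<subseteq> V}"
    have "openin (compact_open_topology T X) ?B"
      unfolding compact_open_topology_def using N(2) V by (intro topology_generated_by_Basis) blast
    from openin_continuous_map_preimage[OF s this]
    have N': "openin Z {z \<in> topspace Z. s z \<in> ?B}" .
    have "s z \<in> continuous_maps T X"
      using continuous_map_image_subset_topspace[OF s] z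
      by (auto simp: topspace_compact_open_topology)
    then have "p \<in> N \<times> {z \<in> topspace Z. s z \<in> ?B}"
      using N p z by auto
    \<comment> \<open>Any time in \<open>N\<close> lies in \<open>K\<close>, and every map in
      \<open>?B\<close> sends all of \<open>K\<close> into \<open>V\<close>.\<close>
    moreover have "N \<times> {z \<in> topspace Z. s z \<in> ?B} \<subseteq> ?W"
      using N(4,5) by auto
    ultimately show "\<exists>M. openin (prod_topology T Z) M \<and> p \<in> M \<and> M \<subseteq> ?W"
      using N(1) N' by (intro exI[of _ "N \<times> {z \<in> topspace Z. s z \<in> ?B}"])
        (simp only: openin_prod_Times_iff simp_thms)
  qed
  show ?thesis
    unfolding continuous_map
  proof (intro conjI allI impI opn)
    show "(\<lambda>(t, z). s z t) ` topspace (prod_topology T Z) \<subseteq> topspace X"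
      using cont by (auto simp: continuous_map_def Pi_iff)
  qed
qed

text \<open>Being Hausdorff upgrades the existence of compact neighbourhoods to arbitrarily small
  ones, the form of local compactness used for uncurrying.\<close>

lemma neighbourhood_base_of_compactin_unit_interval:
  "neighbourhood_base_of (compactin (top_of_set {0..1::real})) (top_of_set {0..1})"
proof -
  have "compact_space (top_of_set {0..1::real})"
    by (simp add: compact_space_subtopology)
  then show ?thesis
    using compact_imp_locally_compact_space locally_compact_space_neighbourhood_base
      Hausdorff_space_subtopology Hausdorff_space_euclidean by blast
qed

lemma admits_motion_planner_iff_homotopic:
  assumes "A \<subseteq> topspace X \<times> topspace X" and UA: "U \<subseteq> A"
  shows "admits_motion_planner X A U \<longleftrightarrow>
    homotopic_with (\<lambda>_. True) (subtopology (prod_topology X X) U) X fst snd"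
    (is "_ \<longleftrightarrow> homotopic_with _ ?Z _ _ _")
proof -
  have Z: "topspace ?Z = U"
    using assms by auto
  let ?T = "top_of_set {0..1::real}"
  show ?thesis
  proof
    assume "admits_motion_planner X A U"
    then obtain s where s: "continuous_map ?Z (path_space_on X A) s"
      and ends: "\<And>x y. (x, y) \<in> U \<Longrightarrow> s (x, y) 0 = x \<and> s (x, y) 1 = y"
      unfolding admits_motion_planner_def by blast
    have "continuous_map ?Z (compact_open_topology ?T X) s"
      using s by (simp add: path_space_on_def path_space_def continuous_map_in_subtopology)
    from continuous_map_uncurry_compact_open[OF neighbourhood_base_of_compactin_unit_interval this]
    \<comment> \<open>The rule \<open>homotopic_with\<close> asks for the end maps only on the
      carrier \<open>U\<close>, which is where the planner's endpoints are known.\<close>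
    show "homotopic_with (\<lambda>_. True) ?Z X fst snd"
      using ends Z by (subst homotopic_with) (auto intro!: exI[of _ "\<lambda>(t, z). s z t"])
  next
    assume "homotopic_with (\<lambda>_. True) ?Z X fst snd"
    \<comment> \<open>The raw definition provides the end equations at every \<open>z\<close>, so
      they can serve as unconditional rewrite rules.\<close>
    then obtain h where h: "continuous_map (prod_topology ?T ?Z) X h"
      and h0: "\<And>z. h (0, z) = fst z" and h1: "\<And>z. h (1, z) = snd z"
      unfolding homotopic_with_def by blast
    let ?s = "\<lambda>z. restrict (\<lambda>t. h (t, z)) {0..1}"
    have "continuous_map ?Z (path_space_on X A) ?s"
      using continuous_map_curry_compact_open[OF h] UA Z
      by (auto simp: path_space_on_def path_space_def continuous_map_in_subtopology h0 h1)
    then show "admits_motion_planner X A U"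
      unfolding admits_motion_planner_def by (auto intro!: exI[of _ ?s] simp: h0 h1)
  qed
qed

text \<open>A cover by one set must consist of \<open>A\<close> itself, and \<open>A\<close> is open
  in its own subspace exactly when it lies in the carrier of the product. The value 0 is excluded
  because an empty union cannot be the nonempty \<open>A\<close>.\<close>

lemma TC_eq_1_iff:
  assumes "A \<noteq> {}"
  shows "TC X A = 1 \<longleftrightarrow> admits_motion_planner X A A \<and> A \<subseteq> topspace X \<times> topspace X"
proof -
  let ?P = "\<lambda>k. \<exists>U :: nat \<Rightarrow> ('a \<times> 'a) set.
     (\<forall>i<k. openin (subtopology (prod_topology X X) A) (U i) \<and> admits_motion_planner X A (U i)) \<and>
     A = (\<Union>i<k. U i)"
  have TC: "TC X A = Inf {enat k | k. ?P k}"
    by (simp add: TC_def)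
  have P1: "?P 1 \<longleftrightarrow> admits_motion_planner X A A \<and> A \<subseteq> topspace X \<times> topspace X"
  proof -
    have "openin (subtopology (prod_topology X X) A) A \<longleftrightarrow> A \<subseteq> topspace X \<times> topspace X"
      by (metis inf.absorb_iff2 openin_subset openin_topspace topspace_prod_topology
          topspace_subtopology le_inf_iff)
    then show ?thesis
      by (auto simp: lessThan_Suc)
  qed
  have P0: "\<not> ?P 0"
    using assms by simp
  have "TC X A = 1 \<longleftrightarrow> ?P 1"
  proof
    assume TC1: "TC X A = 1"
    \<comment> \<open>An empty set would have infimum \<open>\<infinity>\<close>. For a nonempty set
      in \<open>enat\<close> the infimum is a least element, so the value 1 is attained by an actual
      cover.\<close>
    then have "{enat k | k. ?P k} \<noteq> {}"
      unfolding TC by (metis Inf_empty top_enat_def infinity_ne_i1)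
    then have "Inf {enat k | k. ?P k} \<in> {enat k | k. ?P k}"
      unfolding Inf_enat_def by (metis (mono_tags, lifting) LeastI ex_in_conv)
    then have "1 \<in> {enat k | k. ?P k}"
      unfolding TC1[unfolded TC] .
    then obtain k where "1 = enat k" "?P k"
      by blast
    then show "?P 1"
      by (simp add: one_enat_def)
  next
    assume "?P 1"
    then have "TC X A \<le> 1"
      unfolding TC one_enat_def by (intro Inf_lower) blast
    moreover have "1 \<le> TC X A"
      unfolding TC
    proof (rule Inf_greatest)
      fix m assume "m \<in> {enat k | k. ?P k}"
      then obtain k where "m = enat k" "?P k"
        by blast
      then show "1 \<le> m"
        using P0 by (cases k) (auto simp: one_enat_def)
    qed
    ultimately show "TC X A = 1"
      by simp
  qed
  then show ?thesis
    using P1 by simp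
qed

lemma homotopic_fst_snd_iff_nullhomotopic:
  assumes X: "path_connected_space X"
    and Y: "Y1 \<subseteq> topspace X" "Y2 \<subseteq> topspace X" "Y1 \<noteq> {}" "Y2 \<noteq> {}"
  shows "homotopic_with (\<lambda>_. True) (prod_topology (subtopology X Y1) (subtopology X Y2)) X fst snd \<longleftrightarrow>
    nullhomotopic (subtopology X Y1) X (\<lambda>x. x) \<and> nullhomotopic (subtopology X Y2) X (\<lambda>x. x)"
    (is "?hom \<longleftrightarrow> _")
proof
  assume hom: ?hom
  obtain y1 y2 where y: "y1 \<in> Y1" "y2 \<in> Y2"
    using Y by blast
  \<comment> \<open>On the slice at \<open>y2\<close>, \<open>fst\<close> becomes the inclusion of
    \<open>Y1\<close> and \<open>snd\<close> the constant \<open>y2\<close>. The slice at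
    \<open>y1\<close> below exchanges the roles, hence the later use of symmetry.\<close>
  have "continuous_map (subtopology X Y1) (prod_topology (subtopology X Y1) (subtopology X Y2))
      (\<lambda>x. (x, y2))"
    using y Y by (intro continuous_map_pairedI) auto
  from homotopic_with_compose_continuous_map_right[OF hom this]
  have 1: "homotopic_with (\<lambda>_. True) (subtopology X Y1) X (\<lambda>x. x) (\<lambda>_. y2)"
    by (simp add: o_def)
  have "continuous_map (subtopology X Y2) (prod_topology (subtopology X Y1) (subtopology X Y2))
      (\<lambda>x. (y1, x))"
    using y Y by (intro continuous_map_pairedI) auto
  from homotopic_with_compose_continuous_map_right[OF hom this]
  have "homotopic_with (\<lambda>_. True) (subtopology X Y2) X (\<lambda>_. y1) (\<lambda>x. x)"
    by (simp add: o_def)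
  with 1 show "nullhomotopic (subtopology X Y1) X (\<lambda>x. x) \<and> nullhomotopic (subtopology X Y2) X (\<lambda>x. x)"
    unfolding nullhomotopic_def using y Y by (auto dest: homotopic_with_symD)
next
  let ?Z = "prod_topology (subtopology X Y1) (subtopology X Y2)"
  assume "nullhomotopic (subtopology X Y1) X (\<lambda>x. x) \<and> nullhomotopic (subtopology X Y2) X (\<lambda>x. x)"
  then obtain c1 c2 where c: "c1 \<in> topspace X" "c2 \<in> topspace X"
    and 1: "homotopic_with (\<lambda>_. True) (subtopology X Y1) X (\<lambda>x. x) (\<lambda>_. c1)"
    and 2: "homotopic_with (\<lambda>_. True) (subtopology X Y2) X (\<lambda>x. x) (\<lambda>_. c2)"
    unfolding nullhomotopic_def by blast
  have "homotopic_with (\<lambda>_. True) ?Z X fst (\<lambda>_. c1)"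
    using homotopic_with_compose_continuous_map_right[OF 1 continuous_map_fst, of "\<lambda>_. True"]
    by (simp add: o_def)
  \<comment> \<open>The two contractions may end at different points; a path from \<open>c1\<close>
    to \<open>c2\<close> joins them and completes the chain from \<open>fst\<close> to
    \<open>snd\<close>.\<close>
  moreover have "homotopic_with (\<lambda>_. True) ?Z X (\<lambda>_. c1) (\<lambda>_. c2)"
    using X c by (simp add: homotopic_constant_maps path_connected_space_iff_path_component)
  moreover have "homotopic_with (\<lambda>_. True) ?Z X snd (\<lambda>_. c2)"
    using homotopic_with_compose_continuous_map_right[OF 2 continuous_map_snd, of "\<lambda>_. True"]
    by (simp add: o_def)
  ultimately show ?hom
    by (meson homotopic_with_symD homotopic_with_trans)
qed

theorem theorem2p5:
  fixes X :: "'a topology" and Y1 Y2 :: "'a set"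
  assumes "path_connected_space X"
    and "Y1 \<subseteq> topspace X" and "Y2 \<subseteq> topspace X"
    and "Y1 \<noteq> {}" and "Y2 \<noteq> {}"
  shows "TC X (Y1 \<times> Y2) = 1 \<longleftrightarrow>
    nullhomotopic (subtopology X Y1) X (\<lambda>x. x) \<and> nullhomotopic (subtopology X Y2) X (\<lambda>x. x)"
proof -
  have sub: "Y1 \<times> Y2 \<subseteq> topspace X \<times> topspace X"
    using assms by blast
  have "TC X (Y1 \<times> Y2) = 1 \<longleftrightarrow> admits_motion_planner X (Y1 \<times> Y2) (Y1 \<times> Y2)"
    using assms sub by (subst TC_eq_1_iff) auto
  \<comment> \<open>The subspace topology on \<open>Y1 \<times> Y2\<close> is the product of the
    subspace topologies, which matches the two equivalences.\<close>
  then show ?thesis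
    using admits_motion_planner_iff_homotopic[OF sub subset_refl]
      homotopic_fst_snd_iff_nullhomotopic[OF assms]
    by (simp add: subtopology_Times)
qed

end
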